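(* Let $m\ge 2$, $n\ge 1$, $A\colon\mathbb{N}^m\to\mathcal{M}_n(\mathbb{R})$ and $b\colon\mathbb{N}^m\to\mathbb{R}^n$. Let $f_1,\dots,f_m\colon\mathbb{N}^{m-1}\to\mathbb{R}^n$ be such that for any distinct $\alpha,\beta\in\{1,\dots,m\}$, $$f_\alpha(t^1,\ldots,\widehat{t^\alpha},\ldots,t^m)\Big|_{t^\beta=0}=f_\beta(t^1,\ldots,\widehat{t^\beta},\ldots,t^m)\Big|_{t^\alpha=0}$$ for all values in $\mathbb{N}$ of the remaining variables $t^\gamma$, $\gamma\notin\{\alpha,\beta\}$. Then there is a unique $x\colon\mathbb{N}^m\to\mathbb{R}^n$ which verifies $$x(t+\mathbf{1})=A(t)x(t)+b(t),\quad\forall t\in\mathbb{N}^m,$$ $$x(t)\Big|_{t^\beta=0}=f_\beta(t^1,\ldots,\widehat{t^\beta},\ldots,t^m),\quad\forall (t^1,\ldots,\widehat{t^\beta},\ldots,t^m)\in\mathbb{N}^{m-1},\ \forall\beta\in\{1,\dots,m\},$$ and (besides these prescribed values at the points $t$ with $\mu(t)=0$) it is given, for any $\beta$ with $t^\beta=\mu(t)$, by the formula $$x(t)=A(t-\mathbf{1})A(t-2\cdot\mathbf{1})\cdots A(t-t^\beta\cdot\mathbf{1})\,f_\beta(t^1-t^\beta,\ldots,\widehat{t^\beta},\ldots,t^m-t^\beta)+b(t-\mathbf{1})$$ $$\qquad+\sum_{k=2}^{t^\beta}A(t-\mathbf{1})A(t-2\cdot\mathbf{1})\cdots A(t-(k-1)\cdot\mathbf{1})\,b(t-k\cdot\mathbf{1}),\qquad\text{if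 }\mu(t)=t^\beta\ge 2,$$ and by the formula $$x(t)=A(t^1-1,\ldots,t^{\beta-1}-1,0,t^{\beta+1}-1,\ldots,t^m-1)\,f_\beta(t^1-1,\ldots,\widehat{t^\beta},\ldots,t^m-1)$$ $$\qquad+b(t^1-1,\ldots,t^{\beta-1}-1,0,t^{\beta+1}-1,\ldots,t^m-1),\qquad\text{if }\mu(t)=t^\beta=1.$$
   Context: $\mathbb{N}=\{0,1,2,\dots\}$; $\mathcal{M}_n(\mathbb{R})$ is the set of real $n\times n$ matrices; elements of $\mathbb{R}^n$ are column vectors. For $t=(t^1,\dots,t^m)\in\mathbb{N}^m$ the superscripts are indices, not powers; $\mathbf{1}=(1,\dots,1)\in\mathbb{N}^m$; $\mu(t)=\min\{t^1,\dots,t^m\}$. The hat denotes omission: $(t^1,\ldots,\widehat{t^\beta},\ldots,t^m)=(t^1,\ldots,t^{\beta-1},t^{\beta+1},\ldots,t^m)\in\mathbb{N}^{m-1}$; similarly $(t^1-c,\ldots,\widehat{t^\beta},\ldots,t^m-c)$ is the tuple of all $t^\gamma-c$ with $\gamma\neq\beta$, in increasing order of $\gamma$. *)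

theory Defs
  imports "HOL-Analysis.Analysis"
begin

text \<open>
  Elements of \<open>\<nat>\<^sup>m\<close> are lists of length \<open>m\<close>, so that \<open>\<nat>\<^sup>m\<close> and \<open>\<nat>\<^sup>m\<^sup>-\<^sup>1\<close> live in the same type.
  Positions are counted from \<open>0\<close>: the coordinate \<open>t\<^sup>\<beta>\<close> with \<open>\<beta> \<in> {1,\<dots>,m}\<close> is \<open>t ! (\<beta> - 1)\<close>.
\<close>

definition tuples :: "nat \<Rightarrow> nat list set" where
  "tuples m = {t. length t = m}"

definition omit :: "nat \<Rightarrow> nat list \<Rightarrow> nat list" where
  "omit \<beta> t = take \<beta> t @ drop (Suc \<beta>) t"

definition \<mu> :: "nat list \<Rightarrow> nat" where
  "\<mu> t = Min (set t)"

definition shift_up :: "nat list \<Rightarrow> nat list" where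
  "shift_up t = map (\<lambda>a. a + 1) t"

text \<open>
  \<open>shift_down c t\<close> is \<open>t - c \<cdot> \<one>\<close>. The subtraction truncates, so this reading needs \<open>c \<le> \<mu> t\<close>.
\<close>

definition shift_down :: "nat \<Rightarrow> nat list \<Rightarrow> nat list" where
  "shift_down c t = map (\<lambda>a. a - c) t"

text \<open>The ordered product \<open>A(t - \<one>) A(t - 2 \<cdot> \<one>) \<cdots> A(t - s \<cdot> \<one>)\<close>:\<close>

definition back_prod :: "(nat list \<Rightarrow> real^'n^'n) \<Rightarrow> nat list \<Rightarrow> nat \<Rightarrow> real^'n^'n" where
  "back_prod A t s = foldr (**) (map (\<lambda>j. A (shift_down j t)) [1..<Suc s]) (mat 1)"

text \<open>
  \<open>F|\<^bsub>t\<^sup>\<beta>=0\<^esub>\<close> is rendered by evaluating \<open>F\<close> at \<open>t[\<beta> := 0]\<close>.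
\<close>

definition compatible :: "nat \<Rightarrow> (nat \<Rightarrow> nat list \<Rightarrow> real^'n) \<Rightarrow> bool" where
  "compatible m f \<longleftrightarrow>
     (\<forall>\<alpha><m. \<forall>\<beta><m. \<alpha> \<noteq> \<beta> \<longrightarrow>
       (\<forall>t\<in>tuples m. f \<alpha> (omit \<alpha> (t[\<beta> := 0])) = f \<beta> (omit \<beta> (t[\<alpha> := 0]))))"

text \<open>
  The unknown \<open>x\<close> is a function on \<open>\<nat>\<^sup>m\<close> only; extensionality outside \<open>tuples m\<close> makes HOL equality
  of such functions coincide with equality on \<open>\<nat>\<^sup>m\<close>.
\<close>

definition is_solution ::
  "nat \<Rightarrow> (nat list \<Rightarrow> real^'n^'n) \<Rightarrow> (nat list \<Rightarrow> real^'n) \<Rightarrow> (nat \<Rightarrow> nat list \<Rightarrow> real^'n)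
    \<Rightarrow> (nat list \<Rightarrow> real^'n) \<Rightarrow> bool" where
  "is_solution m A b f x \<longleftrightarrow>
     x \<in> tuples m \<rightarrow>\<^sub>E UNIV \<and>
     (\<forall>t\<in>tuples m. x (shift_up t) = A t *v x t + b t) \<and>
     (\<forall>t\<in>tuples m. \<forall>\<beta><m. x (t[\<beta> := 0]) = f \<beta> (omit \<beta> t))"

end

theory Submission
  imports Defs
begin

text \<open>
  The translates of \<open>\<one>\<close> cut \<open>\<nat>\<^sup>m\<close> into disjoint diagonal rays, each issuing from exactly one point with
  a vanishing coordinate: the ray through \<open>t\<close> starts at \<open>t - \<mu>(t) \<cdot> \<one>\<close>. The recurrence relates only
  consecutive points of a ray, so along every ray it is an ordinary affine first-order recurrence,
  and the boundary condition provides its initial value. This already gives uniqueness: iterating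
  the recurrence back to the start of the ray (lemma \<open>variation_of_constants\<close>) expresses \<open>x(t)\<close> in
  terms of \<open>A\<close>, \<open>b\<close> and the boundary value there, which is also the claimed formula.

  For existence, one runs the recurrence forward along each ray. The only possible obstruction is
  at starting points having several zero coordinates, where several \<open>f\<^sub>\<beta>\<close> prescribe a value;
  compatibility says precisely that they prescribe the same one (lemma \<open>compatible_boundary\<close>), so
  that any zero coordinate may be used to define the initial value.
\<close>

section \<open>Diagonal rays\<close>

lemma shift_down_in_tuples: "t \<in> tuples m \<Longrightarrow> shift_down c t \<in> tuples m"
  by (simp add: tuples_def shift_down_def)

lemma shift_up_in_tuples: "t \<in> tuples m \<Longrightarrow> shift_up t \<in> tuples m"
  by (simp add: tuples_def shift_up_def)

lemma shift_down_shift_down: "shift_down c (shift_down d t) = shift_down (d + c) t"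
  by (simp add: shift_down_def)

lemma shift_down_0: "shift_down 0 t = t"
  by (simp add: shift_down_def)

lemma shift_down_shift_up: "shift_down 1 (shift_up t) = t"
  by (simp add: shift_down_def shift_up_def comp_def)

lemma \<mu>_le: "a \<in> set t \<Longrightarrow> \<mu> t \<le> a"
  by (simp add: \<mu>_def)

lemma \<mu>_attained:
  assumes "t \<in> tuples m" "m > 0"
  obtains \<beta> where "\<beta> < m" "t ! \<beta> = \<mu> t"
proof -
  have "\<mu> t \<in> set t"
    unfolding \<mu>_def using assms by (intro Min_in) (auto simp: tuples_def)
  then show ?thesis
    using that assms by (auto simp: in_set_conv_nth tuples_def)
qed

lemma shift_up_shift_down:
  assumes "\<mu> t > c"
  shows "shift_up (shift_down (Suc c) t) = shift_down c t"
proof -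
  have "a - Suc c + 1 = a - c" if "a \<in> set t" for a
    using \<mu>_le[OF that] assms by simp
  then show ?thesis
    by (simp add: shift_up_def shift_down_def)
qed

lemma \<mu>_shift_up:
  assumes "t \<noteq> []"
  shows "\<mu> (shift_up t) = Suc (\<mu> t)"
proof -
  have "Min (Suc ` set t) = Suc (Min (set t))"
    using assms by (intro mono_Min_commute[symmetric]) (auto simp: mono_def)
  then show ?thesis
    by (simp add: \<mu>_def shift_up_def)
qed

lemma \<mu>_eq_0:
  assumes "t \<in> tuples m" "\<beta> < m" "t ! \<beta> = 0"
  shows "\<mu> t = 0"
  using \<mu>_le[OF nth_mem, of \<beta> t] assms by (simp add: tuples_def)

section \<open>Boundary values\<close>

lemma omit_list_update: "omit \<beta> (t[\<beta> := a]) = omit \<beta> t"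
  by (simp add: omit_def)

lemma list_update_eq_self: "t ! \<beta> = a \<Longrightarrow> t[\<beta> := a] = t"
  by (metis list_update_id)

lemma is_solution_boundary:
  assumes "is_solution m A b f x" "t \<in> tuples m" "\<beta> < m" "t ! \<beta> = 0"
  shows "x t = f \<beta> (omit \<beta> t)"
proof -
  have "x (t[\<beta> := 0]) = f \<beta> (omit \<beta> t)"
    using assms by (simp add: is_solution_def)
  then show ?thesis
    by (simp only: list_update_eq_self[OF assms(4)])
qed

lemma compatible_boundary:
  assumes "compatible m f" "t \<in> tuples m"
    and "\<alpha> < m" "\<beta> < m" "t ! \<alpha> = 0" "t ! \<beta> = 0"
  shows "f \<alpha> (omit \<alpha> t) = f \<beta> (omit \<beta> t)"
proof (cases "\<alpha> = \<beta>")
  case False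
  then have "f \<alpha> (omit \<alpha> (t[\<beta> := 0])) = f \<beta> (omit \<beta> (t[\<alpha> := 0]))"
    using assms by (auto simp: compatible_def)
  then show ?thesis
    using assms list_update_eq_self by metis
qed simp

section \<open>The formula along a ray\<close>

lemma is_solution_step_down:
  assumes "is_solution m A b f x" "t \<in> tuples m" "s < \<mu> t"
  shows "x (shift_down s t) =
    A (shift_down (Suc s) t) *v x (shift_down (Suc s) t) + b (shift_down (Suc s) t)"
proof -
  let ?u = "shift_down (Suc s) t"
  have "x (shift_up ?u) = A ?u *v x ?u + b ?u"
    using assms(1) shift_down_in_tuples[OF assms(2)] by (simp add: is_solution_def)
  then show ?thesis
    by (simp add: shift_up_shift_down[OF assms(3)])
qed

lemma foldr_matrix_mult_append:
  fixes B :: "real^'n^'n"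
  shows "foldr (**) (Bs @ [B]) (mat 1) = foldr (**) Bs (mat 1) ** B"
  by (induction Bs) (simp_all add: matrix_mul_assoc)

lemma back_prod_0: "back_prod A t 0 = mat 1"
  by (simp add: back_prod_def)

lemma back_prod_Suc: "back_prod A t (Suc s) = back_prod A t s ** A (shift_down (Suc s) t)"
proof -
  have "[1..<Suc (Suc s)] = [1..<Suc s] @ [Suc s]"
    by simp
  then show ?thesis
    unfolding back_prod_def by (simp only: map_append list.map foldr_matrix_mult_append)
qed

text \<open>
  Each induction step expands the value at \<open>t - s \<cdot> \<one>\<close> by one use of the recurrence, so the new
  factor of the product appears on the right. Allowing every \<open>s \<le> \<mu> t\<close> makes this induction work;
  \<open>s = \<mu> t\<close> reaches the boundary.
\<close>

lemma variation_of_constants: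
  assumes "is_solution m A b f x" "t \<in> tuples m" "s \<le> \<mu> t"
  shows "x t = back_prod A t s *v x (shift_down s t)
    + (\<Sum>k = 1..s. back_prod A t (k - 1) *v b (shift_down k t))"
  using assms(3)
proof (induction s)
  case 0
  then show ?case
    by (simp add: back_prod_0 shift_down_0)
next
  case (Suc s)
  have "back_prod A t s *v x (shift_down s t) =
      back_prod A t (Suc s) *v x (shift_down (Suc s) t)
        + back_prod A t s *v b (shift_down (Suc s) t)"
    using is_solution_step_down[OF assms(1,2), of s] Suc.prems
    by (simp add: back_prod_Suc matrix_vector_right_distrib matrix_vector_mul_assoc)
  then show ?case
    using Suc by (simp add: algebra_simps)
qed

lemma solution_formula:
  assumes "is_solution m A b f x" "t \<in> tuples m" "\<beta> < m" "t ! \<beta> = \<mu> t"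
  shows "x t = back_prod A t (\<mu> t) *v f \<beta> (omit \<beta> (shift_down (\<mu> t) t))
    + (\<Sum>k = 1..\<mu> t. back_prod A t (k - 1) *v b (shift_down k t))"
proof -
  have "shift_down (\<mu> t) t ! \<beta> = 0"
    using assms by (simp add: shift_down_def tuples_def)
  then have "x (shift_down (\<mu> t) t) = f \<beta> (omit \<beta> (shift_down (\<mu> t) t))"
    using assms by (intro is_solution_boundary[OF assms(1)] shift_down_in_tuples)
  then show ?thesis
    using variation_of_constants[OF assms(1,2), of "\<mu> t"] by simp
qed

section \<open>Existence and uniqueness\<close>

lemma is_solution_unique:
  assumes "m > 0" "is_solution m A b f x" "is_solution m A b f y"
  shows "x = y"
proof (rule PiE_ext)
  show "x \<in> tuples m \<rightarrow>\<^sub>E UNIV" "y \<in> tuples m \<rightarrow>\<^sub>E UNIV"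
    using assms by (simp_all add: is_solution_def)
next
  fix t
  assume t: "t \<in> tuples m"
  obtain \<beta> where "\<beta> < m" "t ! \<beta> = \<mu> t"
    using \<mu>_attained[OF t assms(1)] .
  then show "x t = y t"
    by (simp only: solution_formula[OF assms(2) t] solution_formula[OF assms(3) t])
qed

text \<open>
  The solution arises from the choice \<open>s = \<mu> t\<close>, with \<open>g\<close> the boundary data. Keeping \<open>s\<close> independent
  of \<open>t\<close> makes the recursion primitive.
\<close>

primrec run_forward ::
  "(nat list \<Rightarrow> real^'n^'n) \<Rightarrow> (nat list \<Rightarrow> real^'n) \<Rightarrow> (nat list \<Rightarrow> real^'n)
    \<Rightarrow> nat \<Rightarrow> nat list \<Rightarrow> real^'n" where
  "run_forward A b g 0 t = g t"
| "run_forward A b g (Suc s) t =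
    A (shift_down 1 t) *v run_forward A b g s (shift_down 1 t) + b (shift_down 1 t)"

lemma is_solution_exists:
  assumes "m > 0" "compatible m f"
  shows "\<exists>x. is_solution m A b f x"
proof -
  \<comment> \<open>The initial value may be read off at any zero coordinate, by compatibility.\<close>
  define g where "g t = (let \<beta> = (SOME \<beta>. \<beta> < m \<and> t ! \<beta> = 0) in f \<beta> (omit \<beta> t))" for t
  have g: "g t = f \<beta> (omit \<beta> t)" if "t \<in> tuples m" "\<beta> < m" "t ! \<beta> = 0" for t \<beta>
  proof -
    define \<alpha> where "\<alpha> = (SOME \<alpha>. \<alpha> < m \<and> t ! \<alpha> = 0)"
    have "\<alpha> < m \<and> t ! \<alpha> = 0"
      unfolding \<alpha>_def by (rule someI[of _ \<beta>]) (simp add: that)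
    then show ?thesis
      using compatible_boundary[OF assms(2) that(1), of \<alpha> \<beta>] that
      by (simp add: g_def \<alpha>_def Let_def)
  qed
  define x where "x = (\<lambda>t\<in>tuples m. run_forward A b g (\<mu> t) t)"
  have "x (shift_up t) = A t *v x t + b t" if "t \<in> tuples m" for t
  proof -
    have "t \<noteq> []"
      using that assms(1) by (auto simp: tuples_def)
    then show ?thesis
      using that shift_up_in_tuples[OF that] shift_down_shift_up[of t]
      by (simp add: x_def \<mu>_shift_up)
  qed
  moreover have "x (t[\<beta> := 0]) = f \<beta> (omit \<beta> t)" if "t \<in> tuples m" "\<beta> < m" for t \<beta>
  proof -
    have t0: "t[\<beta> := 0] \<in> tuples m" "t[\<beta> := 0] ! \<beta> = 0"
      using that by (simp_all add: tuples_def)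
    then have "x (t[\<beta> := 0]) = g (t[\<beta> := 0])"
      using \<mu>_eq_0[OF t0(1) that(2) t0(2)] by (simp add: x_def)
    also have "\<dots> = f \<beta> (omit \<beta> t)"
      using g[OF t0(1) that(2) t0(2)] by (simp add: omit_list_update)
    finally show ?thesis .
  qed
  ultimately have "is_solution m A b f x"
    by (simp add: is_solution_def x_def)
  then show ?thesis
    by blast
qed

theorem theorem1:
  fixes m :: nat
    and A :: "nat list \<Rightarrow> real^'n^'n"
    and b :: "nat list \<Rightarrow> real^'n"
    and f :: "nat \<Rightarrow> nat list \<Rightarrow> real^'n"
  assumes "m \<ge> 2"
    and "compatible m f"
  shows "(\<exists>!x. is_solution m A b f x) \<and>
    (\<forall>x. is_solution m A b f x \<longrightarrow>
      (\<forall>t\<in>tuples m. \<forall>\<beta><m. t ! \<beta> = \<mu> t \<longrightarrow>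
        (t ! \<beta> \<ge> 2 \<longrightarrow>
          x t = back_prod A t (t ! \<beta>) *v f \<beta> (omit \<beta> (shift_down (t ! \<beta>) t))
                + b (shift_down 1 t)
                + (\<Sum>k = 2..t ! \<beta>. back_prod A t (k - 1) *v b (shift_down k t))) \<and>
        (t ! \<beta> = 1 \<longrightarrow>
          x t = A ((shift_down 1 t)[\<beta> := 0]) *v f \<beta> (omit \<beta> (shift_down 1 t))
                + b ((shift_down 1 t)[\<beta> := 0]))))"
proof (intro conjI allI impI ballI)
  have "m > 0"
    using assms(1) by simp
  show "\<exists>!x. is_solution m A b f x"
    using is_solution_exists[OF \<open>m > 0\<close> assms(2)] is_solution_unique[OF \<open>m > 0\<close>]
    by (rule ex_ex1I)
next
  fix x t \<beta>
  assume x: "is_solution m A b f x" and t: "t \<in> tuples m" and \<beta>: "\<beta> < m" "t ! \<beta> = \<mu> t"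
  note formula = solution_formula[OF x t \<beta>, folded \<beta>(2)]
  {
    assume "t ! \<beta> \<ge> 2"
    then have "{1..t ! \<beta>} = insert 1 {2..t ! \<beta>}"
      by auto
    then show "x t = back_prod A t (t ! \<beta>) *v f \<beta> (omit \<beta> (shift_down (t ! \<beta>) t))
                + b (shift_down 1 t)
                + (\<Sum>k = 2..t ! \<beta>. back_prod A t (k - 1) *v b (shift_down k t))"
      using formula by (simp add: back_prod_0 add.assoc)
  next
    assume 1: "t ! \<beta> = 1"
    then have "shift_down 1 t ! \<beta> = 0"
      using t \<beta> by (simp add: shift_down_def tuples_def)
    then have "(shift_down 1 t)[\<beta> := 0] = shift_down 1 t"
      by (rule list_update_eq_self)
    then show "x t = A ((shift_down 1 t)[\<beta> := 0]) *v f \<beta> (omit \<beta> (shift_down 1 t))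
                + b ((shift_down 1 t)[\<beta> := 0])"
      using formula 1 back_prod_Suc[of A t 0] by (simp add: back_prod_0)
  }
qed

end
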